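(* There is an onto coloring $c:\mathbb{Q}^{[2]}\to\omega$ with the property that, for any $H\subseteq\mathbb{Q}$ homeomorphic to $\mathbb{Q}$, there is $h:\mathbb{Q}\to H$, a homeomorphism onto its range, for which $c(\{x,y\})=c(\{h(x),h(y)\})$ for all $x\neq y$ in $\mathbb{Q}$. In particular, $c$ takes all the values from $\omega$ on $H^{[2]}$.
   Context: $\mathbb{Q}$ is the space of rational numbers with its usual topology (subsets carry the subspace topology); for a set $S$, $S^{[2]}$ is the set of two-element subsets of $S$. *)

theory Defs
  imports "HOL-Analysis.Analysis" "HOL-Library.Ramsey"
begin

end

theory Submission
  imports Defs
begin

text \<open>
  The idea is to turn \<open>\<rat>\<close> into a countable tree in which points converge to a node precisely when
  they climb into later and later branches above it, and to colour a pair of nodes by how often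
  the two branches leading to them interleave.

  Enumerate the rationals as \<open>q 0, q 1, \<dots>\<close> and refine \<open>\<rat>\<close> step by step by a dense sequence of
  irrational cuts. At every stage a rational lies in some piece of the current partition, and
  the ancestors of \<open>q i\<close> are the points which have the least index in the piece of \<open>q i\<close> at some
  stage. Their indices form a finite set \<open>A i\<close> whose largest element is \<open>i\<close>, these sets form a
  tree under end-extension, and \<open>q j\<close> tends to \<open>q i\<close> if and only if \<open>A j\<close> and \<open>A i\<close> agree on
  longer and longer initial segments of the naturals (locale \<open>rational_tree\<close>).

  The colour of a pair is the number of alternations: list the symmetric difference of \<open>A i\<close> and
  \<open>A j\<close> increasingly and count the places where one passes from one of the sets to the other.
  Every number occurs, because the node that currently lags behind can be extended beyond
  the other one, which adds precisely one alternation.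

  Now let \<open>H\<close> be a nonempty set of rationals without isolated points. A map \<open>g\<close> of the tree
  into \<open>H\<close> is built by recursion along the enumeration: \<open>g j\<close> is chosen in \<open>H\<close> above \<open>g p\<close>, where
  \<open>p\<close> is the parent of \<open>j\<close>, and so close to \<open>g p\<close> that all new ancestors exceed everything used
  before. Hence \<open>A (g j)\<close> arises from \<open>A j\<close> by replacing every \<open>i \<in> A j\<close> with a nonempty block of
  numbers, and later blocks lie above earlier ones. Replacing numbers by consecutive blocks
  changes neither the number of alternations (\<open>card_alternations_blocks\<close>) nor, up to
  reindexing, which initial segments agree; therefore \<open>g\<close> preserves the colouring and is a
  topological embedding.
\<close>

section \<open>Alternations between finite sets of naturals\<close>

text \<open>
  The definition speaks of a family \<open>F\<close> of sets, so that the colour of an unordered pair needs no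
  choice of an order. In the case \<open>F = {s, t}\<close> the set \<open>discord F\<close> is the symmetric difference
  of \<open>s\<close> and \<open>t\<close>.
\<close>

definition discord :: "nat set set \<Rightarrow> nat set"
  where "discord F = \<Union>F - \<Inter>F"

definition alternations :: "nat set set \<Rightarrow> (nat \<times> nat) set"
  where "alternations F = {(a, b). a \<in> discord F \<and> b \<in> discord F \<and> a < b \<and>
    {a<..<b} \<inter> discord F = {} \<and> (\<forall>s\<in>F. \<not> (a \<in> s \<and> b \<in> s))}"

lemma alternationsD:
  assumes "(a, b) \<in> alternations F"
  shows "a \<in> discord F" "b \<in> discord F" "a < b" "{a<..<b} \<inter> discord F = {}"
    "s \<in> F \<Longrightarrow> \<not> (a \<in> s \<and> b \<in> s)"
  using assms by (auto simp: alternations_def)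

lemma finite_alternations:
  assumes "finite (\<Union>F)"
  shows "finite (alternations F)"
proof (rule finite_subset)
  show "alternations F \<subseteq> \<Union>F \<times> \<Union>F"
    by (auto simp: alternations_def discord_def)
qed (use assms in simp)

lemma alternations_subset:
  assumes "t \<subseteq> s"
  shows "alternations {s, t} = {}"
  using assms by (auto simp: alternations_def discord_def)

text \<open>
  Putting a new set on top of \<open>t\<close> when the largest element belongs to \<open>s\<close> creates just one
  further change of sides, at the transition to the new elements.
\<close>

lemma card_alternations_extend:
  assumes fin: "finite s" "finite t" "finite C" and C: "C \<noteq> {}" "\<And>w. w \<in> C \<Longrightarrow> x < w"
    and x: "x \<in> s" "x \<notin> t" and top: "\<And>w. w \<in> s \<union> t \<Longrightarrow> w \<le> x"
  shows "card (alternations {s, t \<union> C}) = Suc (card (alternations {s, t}))"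
proof -
  have D: "discord {s, t \<union> C} = discord {s, t} \<union> C"
    using C(2) top by (fastforce simp: discord_def)
  have D_top: "w \<le> x" if "w \<in> discord {s, t}" for w
    using that top by (auto simp: discord_def)
  have xD: "x \<in> discord {s, t}"
    using x by (auto simp: discord_def)
  have minC: "Min C \<in> C" "\<And>w. w \<in> C \<Longrightarrow> Min C \<le> w"
    using fin C by auto
  have C_new: "w \<notin> s" "w \<notin> t" "w \<notin> discord {s, t}" if "w \<in> C" for w
    using that C(2) top D_top by (fastforce)+
  have "alternations {s, t \<union> C} = insert (x, Min C) (alternations {s, t})"
  proof (intro equalityI subsetI)
    fix p assume "p \<in> alternations {s, t \<union> C}"
    then obtain a b where p: "p = (a, b)" and ab: "a \<in> discord {s, t} \<union> C" "b \<in> discord {s, t} \<union> C"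
      "a < b" and gap: "{a<..<b} \<inter> (discord {s, t} \<union> C) = {}"
      and opp: "\<not> (a \<in> s \<and> b \<in> s)" "\<not> (a \<in> t \<union> C \<and> b \<in> t \<union> C)"
      by (auto simp: alternations_def D)
    show "p \<in> insert (x, Min C) (alternations {s, t})"
    proof (cases "b \<in> C")
      case True
      then have "a \<in> discord {s, t}"
        using ab opp by auto
      then have "a \<le> x"
        using D_top by blast
      have "x < b"
        using C True by blast
      with gap xD \<open>a \<le> x\<close> have "a = x"
        by (metis IntI UnI1 emptyE greaterThanLessThan_iff le_neq_implies_less)
      have "x < Min C" "Min C \<le> b"
        using minC C True by auto
      with gap minC \<open>a = x\<close> have "b = Min C"
        by (metis IntI UnI2 emptyE greaterThanLessThan_iff le_neq_implies_less)
      with \<open>a = x\<close> p show ?thesis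
        by simp
    next
      case False
      then have b: "b \<in> discord {s, t}"
        using ab by auto
      then have "a \<notin> C"
        using C(2) D_top ab(3) by fastforce
      then have "a \<in> discord {s, t}"
        using ab by auto
      with b ab gap opp have "(a, b) \<in> alternations {s, t}"
        by (auto simp: alternations_def)
      with p show ?thesis
        by simp
    qed
  next
    fix p assume "p \<in> insert (x, Min C) (alternations {s, t})"
    then consider "p = (x, Min C)" | "p \<in> alternations {s, t}"
      by blast
    then show "p \<in> alternations {s, t \<union> C}"
    proof cases
      case 1
      have "{x<..<Min C} \<inter> (discord {s, t} \<union> C) = {}"
        using D_top minC(2) by fastforce
      with 1 show ?thesis
        using xD minC(1) C(2) C_new x by (auto simp: alternations_def D)
    next
      case 2
      then obtain a b where p: "p = (a, b)" and ab: "a \<in> discord {s, t}" "b \<in> discord {s, t}"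
        "a < b" and gap: "{a<..<b} \<inter> discord {s, t} = {}"
        and opp: "\<not> (a \<in> s \<and> b \<in> s)" "\<not> (a \<in> t \<and> b \<in> t)"
        by (auto simp: alternations_def)
      have "b \<le> x"
        using D_top ab by blast
      then have "{a<..<b} \<inter> C = {}"
        using C(2) by fastforce
      moreover have "a \<notin> C" "b \<notin> C"
        using C_new ab by auto
      ultimately show ?thesis
        using p ab gap opp by (auto simp: alternations_def D)
    qed
  qed
  moreover have "(x, Min C) \<notin> alternations {s, t}"
    using C_new minC by (auto simp: alternations_def)
  moreover have "finite (alternations {s, t})"
    by (rule finite_alternations) (use fin in auto)
  ultimately show ?thesis
    by simp
qed

text \<open>
  If every number \<open>i\<close> is inflated to a block \<open>a i\<close>, then changes of sides never happen inside a
  block, and they happen between neighbouring blocks as they did between the numbers.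
\<close>

lemma card_alternations_blocks:
  fixes a :: "nat \<Rightarrow> nat set"
  assumes fin: "\<And>i. finite (a i)" and ne: "\<And>i. a i \<noteq> {}"
    and sep: "\<And>i j u v. i < j \<Longrightarrow> u \<in> a i \<Longrightarrow> v \<in> a j \<Longrightarrow> u < v"
  shows "card (alternations ((\<lambda>s. \<Union>i\<in>s. a i) ` F)) = card (alternations F)"
proof -
  let ?B = "\<lambda>s. \<Union>i\<in>s. a i"
  have uniq: "i = j" if "u \<in> a i" "u \<in> a j" for i j u
    using sep that by (metis less_irrefl linorder_less_linear)
  have mem: "u \<in> ?B s \<longleftrightarrow> i \<in> s" if "u \<in> a i" for u i s
    using that uniq by blast
  have disc: "u \<in> discord (?B ` F) \<longleftrightarrow> i \<in> discord F" if "u \<in> a i" for u i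
    using mem[OF that] unfolding discord_def by auto
  have disc_ex: "\<exists>i\<in>discord F. u \<in> a i" if "u \<in> discord (?B ` F)" for u
  proof -
    obtain i where "u \<in> a i"
      using \<open>u \<in> discord (?B ` F)\<close> by (auto simp: discord_def)
    then show ?thesis
      using disc that by blast
  qed
  have Max: "Max (a i) \<in> a i" "\<And>u. u \<in> a i \<Longrightarrow> u \<le> Max (a i)" for i
    using fin ne by auto
  have Min: "Min (a i) \<in> a i" "\<And>u. u \<in> a i \<Longrightarrow> Min (a i) \<le> u" for i
    using fin ne by auto
  have le: "i \<le> j" if "u \<in> a i" "v \<in> a j" "u \<le> v" for i j u v
    using sep that by (meson not_less)
  let ?f = "\<lambda>(i, j). (Max (a i), Min (a j))"
  have "bij_betw ?f (alternations F) (alternations (?B ` F))"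
    unfolding bij_betw_def
  proof (intro conjI equalityI subsetI)
    show "inj_on ?f (alternations F)"
      using uniq Max(1) Min(1) by (auto simp: inj_on_def) metis+
  next
    fix p assume "p \<in> ?f ` alternations F"
    then obtain i j where p: "p = (Max (a i), Min (a j))" and ij: "i \<in> discord F" "j \<in> discord F"
      "i < j" and gap: "{i<..<j} \<inter> discord F = {}" and opp: "\<And>s. s \<in> F \<Longrightarrow> \<not> (i \<in> s \<and> j \<in> s)"
      by (auto simp: alternations_def)
    have "{Max (a i)<..<Min (a j)} \<inter> discord (?B ` F) = {}"
    proof (rule ccontr)
      assume "\<not> ?thesis"
      then obtain w k where w: "Max (a i) < w" "w < Min (a j)" "k \<in> discord F" "w \<in> a k"
        using disc_ex by force
      have "i \<le> k" "k \<le> j"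
        using le Max(1) Min(1) w by (meson less_imp_le)+
      moreover have "k \<noteq> i" "k \<noteq> j"
        using w Max(2)[of w i] Min(2)[of w j] by auto
      ultimately have "k \<in> {i<..<j}"
        by simp
      then show False
        using gap w(3) by blast
    qed
    moreover have "\<not> (Max (a i) \<in> ?B s \<and> Min (a j) \<in> ?B s)" if "s \<in> F" for s
      using opp[OF that] mem[OF Max(1)] mem[OF Min(1)] by blast
    ultimately show "p \<in> alternations (?B ` F)"
      using p ij disc[OF Max(1)] disc[OF Min(1)] sep[OF ij(3) Max(1) Min(1)]
      unfolding alternations_def by blast
  next
    fix p assume "p \<in> alternations (?B ` F)"
    moreover obtain u v where p: "p = (u, v)"
      by (cases p)
    ultimately have alt: "(u, v) \<in> alternations (?B ` F)"
      by simp
    note uv = alternationsD(1-3)[OF alt] and gap = alternationsD(4)[OF alt]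
    have opp: "\<not> (u \<in> ?B s \<and> v \<in> ?B s)" if "s \<in> F" for s
      using alternationsD(5)[OF alt imageI[OF that]] .
    obtain i j where i: "i \<in> discord F" "u \<in> a i" and j: "j \<in> discord F" "v \<in> a j"
      using uv disc_ex by blast
    have opp': "\<not> (i \<in> s \<and> j \<in> s)" if "s \<in> F" for s
      using opp[OF that] mem i j by blast
    have "i \<noteq> j"
      using opp' i by (auto simp: discord_def)
    then have "i < j"
      using le[OF i(2) j(2)] uv(3) by simp
    have no: "w \<notin> discord (?B ` F)" if "u < w" "w < v" for w
      using gap that by auto
    have "u = Max (a i)"
    proof (rule ccontr)
      assume "u \<noteq> Max (a i)"
      then have "u < Max (a i)"
        using Max(2)[OF i(2)] by simp
      then show False
        using no sep[OF \<open>i < j\<close> Max(1) j(2)] disc[OF Max(1)] i(1) by blast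
    qed
    moreover have "v = Min (a j)"
    proof (rule ccontr)
      assume "v \<noteq> Min (a j)"
      then have "Min (a j) < v"
        using Min(2)[OF j(2)] by simp
      then show False
        using no sep[OF \<open>i < j\<close> i(2) Min(1)] disc[OF Min(1)] j(1) by blast
    qed
    moreover have "{i<..<j} \<inter> discord F = {}"
    proof (rule ccontr)
      assume "\<not> ?thesis"
      then obtain k where k: "i < k" "k < j" "k \<in> discord F"
        by auto
      then show False
        using no sep[OF k(1) i(2) Max(1)] sep[OF k(2) Max(1) j(2)] disc[OF Max(1)] by blast
    qed
    ultimately have "p = ?f (i, j)" "(i, j) \<in> alternations F"
      using p i(1) j(1) \<open>i < j\<close> opp' by (simp_all add: alternations_def)
    then show "p \<in> ?f ` alternations F"
      by (rule image_eqI)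
  qed
  then show ?thesis
    by (simp add: bij_betw_same_card)
qed

section \<open>Limit points of copies of the rationals\<close>

lemma rat_islimpt: "x islimpt (\<rat> :: real set)"
  unfolding islimpt_approachable
proof (intro allI impI)
  fix e :: real assume "e > 0"
  then obtain y where "y \<in> \<rat>" "x < y" "y < x + e"
    using Rats_dense_in_real[of x "x + e"] by auto
  then show "\<exists>y\<in>\<rat>. y \<noteq> x \<and> dist y x < e"
    by (intro bexI[of _ y]) (auto simp: dist_real_def)
qed

lemma homeomorphic_rat_islimpt:
  fixes H :: "real set"
  assumes "H homeomorphic (\<rat> :: real set)" "x \<in> H"
  shows "x islimpt H"
proof -
  obtain g f where gf: "homeomorphism H (\<rat> :: real set) g f"
    using assms(1) by (auto simp: homeomorphic_def)
  show ?thesis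
    unfolding islimpt_approachable
  proof (intro allI impI)
    fix e :: real assume "e > 0"
    have gx: "g x \<in> \<rat>" and fgx: "f (g x) = x"
      using gf assms(2) by (auto simp: homeomorphism_def)
    have "continuous_on \<rat> f"
      using gf by (simp add: homeomorphism_def)
    then obtain d where "d > 0" and d: "\<And>y. y \<in> \<rat> \<Longrightarrow> dist y (g x) < d \<Longrightarrow> dist (f y) x < e"
      using gx fgx \<open>e > 0\<close> by (metis continuous_on_iff)
    obtain y where y: "y \<in> \<rat>" "y \<noteq> g x" "dist y (g x) < d"
      using rat_islimpt[of "g x"] \<open>d > 0\<close> by (auto simp: islimpt_approachable)
    moreover have "f y \<in> H" "g (f y) = y"
      using gf y(1) by (auto simp: homeomorphism_def)
    ultimately show "\<exists>y\<in>H. y \<noteq> x \<and> dist y x < e"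
      using d by metis
  qed
qed

section \<open>Trees that carry the topology of the rationals\<close>

abbreviation agree :: "nat \<Rightarrow> nat set \<Rightarrow> nat set \<Rightarrow> bool"
  where "agree N s t \<equiv> s \<inter> {..<N} = t \<inter> {..<N}"

text \<open>
  Here \<open>A i\<close> is the branch from the root \<open>0\<close> to the node \<open>i\<close>, and the last two assumptions say
  that agreement of branches on initial segments describes the neighbourhoods of \<open>q i\<close>.
\<close>

locale rational_tree =
  fixes q :: "nat \<Rightarrow> real" and A :: "nat \<Rightarrow> nat set"
  assumes bij: "bij_betw q UNIV \<rat>"
    and root: "0 \<in> A i"
    and self: "i \<in> A i"
    and below: "A i \<subseteq> {..i}"
    and coherent: "j \<in> A i \<Longrightarrow> A j = A i \<inter> {..j}"
    and near_agree: "\<exists>e>0. \<forall>j. \<bar>q j - q i\<bar> < e \<longrightarrow> agree N (A j) (A i)"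
    and agree_near: "e > 0 \<Longrightarrow> \<exists>N. \<forall>j. agree N (A j) (A i) \<longrightarrow> \<bar>q j - q i\<bar> < e"
begin

lemma finite_branch: "finite (A i)"
  using below finite_subset by blast

text \<open>
  This is the absence of isolated points, expressed by the neighbourhoods that the branches
  provide.
\<close>

definition crowded :: "nat set \<Rightarrow> bool"
  where "crowded K \<longleftrightarrow> (\<forall>p\<in>K. \<forall>N. \<exists>p'\<in>K. p' \<noteq> p \<and> agree N (A p') (A p))"

lemma crowded_extension:
  assumes "crowded K" "p \<in> K"
  obtains p' where "p' \<in> K" "A p \<subset> A p'" "\<And>w. w \<in> A p' - A p \<Longrightarrow> N < w"
proof -
  \<comment> \<open>Agreement beyond \<open>p\<close> itself makes the branch of \<open>p'\<close> an end-extension of that of \<open>p\<close>.\<close>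
  obtain p' where p': "p' \<in> K" "p' \<noteq> p" "agree (Suc (max N p)) (A p') (A p)"
    using assms unfolding crowded_def by blast
  have sub: "A p \<subseteq> A p'"
    using p'(3) below[of p] by fastforce
  then have "p' \<notin> A p"
    using self[of p] below[of p] below[of p'] p'(2) by fastforce
  then have "A p \<subset> A p'"
    using sub self by blast
  moreover have "N < w" if "w \<in> A p' - A p" for w
  proof (rule ccontr)
    assume "\<not> N < w"
    then have "w \<in> A p' \<inter> {..<Suc (max N p)}"
      using that by auto
    then show False
      using that p'(3) by blast
  qed
  ultimately show ?thesis
    using that p'(1) by blast
qed

definition parent :: "nat \<Rightarrow> nat"
  where "parent j = Max (A j - {j})"

lemma parent:
  assumes "j \<noteq> 0"
  shows "parent j < j" "A j = insert j (A (parent j))"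
proof -
  have "parent j \<in> A j - {j}"
    unfolding parent_def by (rule Max_in) (use assms root finite_branch in auto)
  moreover from this show "parent j < j"
    using below[of j] by fastforce
  moreover have "w \<le> parent j" if "w \<in> A j - {j}" for w
    unfolding parent_def by (rule Max_ge) (use that finite_branch in auto)
  ultimately show "A j = insert j (A (parent j))"
    using coherent[of "parent j" j] self by auto
qed

subsection \<open>The colouring\<close>

definition colour :: "real set \<Rightarrow> nat"
  where "colour X = card (alternations ((\<lambda>x. A (inv q x)) ` X))"

lemma inv_q [simp]: "inv q (q i) = i"
  using bij by (simp add: bij_betw_def)

lemma q_inv [simp]: "x \<in> \<rat> \<Longrightarrow> q (inv q x) = x"
  using bij by (metis bij_betw_def f_inv_into_f)

lemma q_rat [simp]: "q i \<in> \<rat>"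
  using bij by (auto simp: bij_betw_def)

lemma q_eq [simp]: "q i = q j \<longleftrightarrow> i = j"
  by (metis inv_q)

lemma colour_pair: "colour {q i, q j} = card (alternations {A i, A j})"
  by (simp add: colour_def)

lemma crowded_index:
  assumes H: "H \<subseteq> \<rat>" and limpt: "\<And>x. x \<in> H \<Longrightarrow> x islimpt H"
  shows "crowded {i. q i \<in> H}"
  unfolding crowded_def
proof (intro ballI allI)
  fix p N assume "p \<in> {i. q i \<in> H}"
  then have "q p islimpt H"
    using limpt by simp
  moreover obtain e where "e > 0" and e: "\<And>j. \<bar>q j - q p\<bar> < e \<Longrightarrow> agree N (A j) (A p)"
    using near_agree by blast
  ultimately obtain y where y: "y \<in> H" "y \<noteq> q p" "dist y (q p) < e"
    by (auto simp: islimpt_approachable)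
  then obtain j where "y = q j"
    using H q_inv by (metis subsetD)
  with y have j: "q j \<in> H" "j \<noteq> p" "\<bar>q j - q p\<bar> < e"
    by (auto simp: dist_real_def)
  show "\<exists>p'\<in>{i. q i \<in> H}. p' \<noteq> p \<and> agree N (A p') (A p)"
    using j(1,2) e[OF j(3)] by blast
qed

lemma crowded_UNIV: "crowded UNIV"
proof -
  have "crowded {i. q i \<in> \<rat>}"
    by (intro crowded_index rat_islimpt) auto
  then show ?thesis
    by simp
qed

text \<open>
  Two nodes climb alternately: the smaller one is extended beyond the larger one, and each
  such step adds one alternation.
\<close>

lemma ex_alternations: "\<exists>x y. y < x \<and> card (alternations {A x, A y}) = k"
proof (induction k)
  case 0
  have "A 0 \<subseteq> A 1"
    using root below[of 0] by fastforce
  then show ?case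
    using alternations_subset by (intro exI[of _ 1] exI[of _ 0]) simp
next
  case (Suc k)
  then obtain x y where xy: "y < x" "card (alternations {A x, A y}) = k"
    by blast
  obtain y' where y': "A y \<subset> A y'" "\<And>w. w \<in> A y' - A y \<Longrightarrow> x < w"
    by (rule crowded_extension[OF crowded_UNIV UNIV_I, of y x]) (erule that)
  have "card (alternations {A x, A y \<union> (A y' - A y)}) = Suc (card (alternations {A x, A y}))"
  proof (rule card_alternations_extend)
    show "x \<notin> A y" "\<And>w. w \<in> A x \<union> A y \<Longrightarrow> w \<le> x"
      using below[of x] below[of y] xy by fastforce+
  qed (use y' self finite_branch in auto)
  moreover have "A y \<union> (A y' - A y) = A y'"
    using y' by blast
  moreover have "x < y'"
  proof -
    obtain w where "w \<in> A y' - A y"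
      using y' by blast
    then show ?thesis
      using y'(2)[of w] below[of y'] by fastforce
  qed
  ultimately show ?case
    using xy(2) by (metis insert_commute)
qed

lemma colour_onto: "colour ` [\<rat>]\<^bsup>2\<^esup> = UNIV"
proof (intro equalityI subsetI UNIV_I)
  fix k :: nat
  obtain x y where "y < x" "card (alternations {A x, A y}) = k"
    using ex_alternations by blast
  then have "colour {q x, q y} = k" "{q x, q y} \<in> [\<rat>]\<^bsup>2\<^esup>"
    by (auto simp: colour_pair nsets_def)
  then show "k \<in> colour ` [\<rat>]\<^bsup>2\<^esup>"
    by blast
qed

subsection \<open>Colour preserving embeddings into crowded sets\<close>

text \<open>
  The image of each node is chosen after those of all smaller ones; the new part of its branch
  lies above all of their branches since \<open>g i\<close> is the largest element of the branch \<open>A (g i)\<close>.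
\<close>

lemma ex_block_map:
  assumes K: "crowded K" "K \<noteq> {}"
  obtains g where "\<And>j. g j \<in> K" "\<And>j. j \<noteq> 0 \<Longrightarrow> A (g (parent j)) \<subset> A (g j)"
    "\<And>i j w. i < j \<Longrightarrow> w \<in> A (g j) - A (g (parent j)) \<Longrightarrow> g i < w"
proof -
  define P where "P g j r \<longleftrightarrow> r \<in> K \<and> (j \<noteq> 0 \<longrightarrow> A (g (parent j)) \<subset> A r \<and>
    (\<forall>i<j. \<forall>w\<in>A r - A (g (parent j)). g i < w))" for g j r
  have "\<exists>g. \<forall>j. P g j (g j)"
  proof (rule dependent_wf_choice[of less_than])
    show "P f x r = P g x r" if "\<And>z. (z, x) \<in> less_than \<Longrightarrow> f z = g z" for f g x r
      using that parent(1)[of x] by (auto simp: P_def)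
  next
    fix j g assume prev: "\<And>i. (i, j) \<in> less_than \<Longrightarrow> P g i (g i)"
    show "\<exists>r. P g j r"
    proof (cases "j = 0")
      case True
      then show ?thesis
        using K by (auto simp: P_def)
    next
      case False
      then have "g (parent j) \<in> K"
        using prev[of "parent j"] parent(1) by (simp add: P_def)
      then obtain r where r: "r \<in> K" "A (g (parent j)) \<subset> A r"
        "\<And>w. w \<in> A r - A (g (parent j)) \<Longrightarrow> Max (g ` {..<j}) < w"
        using crowded_extension[OF K(1), where N = "Max (g ` {..<j})"] by metis
      have "g i < w" if "i < j" "w \<in> A r - A (g (parent j))" for i w
      proof -
        have "g i \<le> Max (g ` {..<j})"
          using that by simp
        then show ?thesis
          using r(3)[OF that(2)] by simp
      qed
      with r show ?thesis
        by (auto simp: P_def)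
    qed
  qed simp
  then obtain g where g: "\<And>j. P g j (g j)"
    by blast
  show ?thesis
  proof (rule that)
    show "g j \<in> K" for j
      using g[of j] by (simp add: P_def)
    show "A (g (parent j)) \<subset> A (g j)" if "j \<noteq> 0" for j
      using g[of j] that by (simp add: P_def)
    show "g i < w" if "i < j" "w \<in> A (g j) - A (g (parent j))" for i j w
      using g[of j] that by (auto simp: P_def)
  qed
qed

text \<open>
  In such a map the branch of an image is the branch of the node with each element inflated to
  a block, so colours persist by the invariance of alternations, and branches agree far out
  if and only if their images do.
\<close>

lemma ex_colour_embedding:
  assumes K: "crowded K" "K \<noteq> {}"
  obtains g where "range g \<subseteq> K" "inj g"
    "\<And>i j. card (alternations {A (g i), A (g j)}) = card (alternations {A i, A j})"
    "\<And>i j N. agree N (A i) (A j) \<Longrightarrow> agree N (A (g i)) (A (g j))"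
    "\<And>N. \<exists>M. \<forall>i j. agree M (A (g i)) (A (g j)) \<longrightarrow> agree N (A i) (A j)"
proof -
  obtain g where gK: "\<And>j. g j \<in> K" and ext: "\<And>j. j \<noteq> 0 \<Longrightarrow> A (g (parent j)) \<subset> A (g j)"
    and new: "\<And>i j w. i < j \<Longrightarrow> w \<in> A (g j) - A (g (parent j)) \<Longrightarrow> g i < w"
    using ex_block_map[OF K] by blast
  define a where "a j = (if j = 0 then A (g 0) else A (g j) - A (g (parent j)))" for j
  have a_sub: "a j \<subseteq> A (g j)" for j
    by (auto simp: a_def)
  have a_ne: "a j \<noteq> {}" for j
    using ext[of j] self[of "g 0"] by (auto simp: a_def)
  have a_fin: "finite (a j)" for j
    using a_sub finite_branch finite_subset by blast
  have a_le: "u \<le> g j" if "u \<in> a j" for u j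
    using that a_sub below by blast
  have a_gt: "g i < u" if "i < j" "u \<in> a j" for i j u
    using that new[of i j u] by (auto simp: a_def split: if_splits)
  have sep: "u < v" if "i < j" "u \<in> a i" "v \<in> a j" for i j u v
    using a_le[OF that(2)] a_gt[OF that(1,3)] by simp
  have mono: "strict_mono g"
  proof (rule strict_monoI)
    fix i j :: nat assume "i < j"
    moreover obtain w where "w \<in> a j"
      using a_ne by blast
    ultimately show "g i < g j"
      using a_gt a_le by (meson less_le_trans)
  qed
  have a_ge: "j \<le> u" if "u \<in> a j" for u j
  proof (cases j)
    case (Suc i)
    then show ?thesis
      using a_gt[of i j u] that strict_mono_imp_increasing[OF mono, of i] by simp
  qed simp
  have branch: "A (g j) = (\<Union>i\<in>A j. a i)" for j
  proof (induction j rule: less_induct)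
    case (less j)
    show ?case
    proof (cases "j = 0")
      case True
      have "A 0 = {0}"
        using root below[of 0] by auto
      with True show ?thesis
        by (simp add: a_def)
    next
      case False
      have "(\<Union>i\<in>A j. a i) = a j \<union> (\<Union>i\<in>A (parent j). a i)"
        using parent(2)[OF False] by simp
      also have "\<dots> = a j \<union> A (g (parent j))"
        using less parent(1)[OF False] by simp
      also have "\<dots> = A (g j)"
        using False ext[OF False] by (auto simp: a_def)
      finally show ?thesis ..
    qed
  qed
  show ?thesis
  proof (rule that)
    show "range g \<subseteq> K"
      using gK by blast
    show "inj g"
      using mono by (rule strict_mono_imp_inj_on)
    show "card (alternations {A (g i), A (g j)}) = card (alternations {A i, A j})" for i j
      using card_alternations_blocks[of a "{A i, A j}", OF a_fin a_ne sep] by (simp add: branch)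
    have half: "A (g i) \<inter> {..<N} \<subseteq> A (g j)" if "A i \<inter> {..<N} \<subseteq> A j" for i j N
    proof
      fix w assume "w \<in> A (g i) \<inter> {..<N}"
      then obtain l where "l \<in> A i" "w \<in> a l" "w < N"
        using branch by auto
      moreover from this have "l < N"
        using a_ge le_less_trans by blast
      ultimately show "w \<in> A (g j)"
        using that branch by auto
    qed
    show "agree N (A (g i)) (A (g j))" if "agree N (A i) (A j)" for i j N
      using half[of i N j] half[of j N i] that by blast
    have backward: "A i \<inter> {..<N} \<subseteq> A j" if sub: "A (g i) \<inter> {..<g N} \<subseteq> A (g j)" for i j N
    proof
      fix l assume l: "l \<in> A i \<inter> {..<N}"
      obtain w where w: "w \<in> a l"
        using a_ne by blast
      have "g l < g N"
        using l mono by (simp add: strict_mono_less)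
      then have "w < g N"
        using a_le[OF w] by simp
      moreover have "w \<in> A (g i)"
        using w l branch by auto
      ultimately have "w \<in> A (g j)"
        using sub by blast
      then obtain l' where "l' \<in> A j" "w \<in> a l'"
        using branch by auto
      then show "l \<in> A j"
        using w sep by (metis less_irrefl linorder_less_linear)
    qed
    show "\<exists>M. \<forall>i j. agree M (A (g i)) (A (g j)) \<longrightarrow> agree N (A i) (A j)" for N
    proof (intro exI allI impI)
      fix i j assume "agree (g N) (A (g i)) (A (g j))"
      then show "agree N (A i) (A j)"
        using backward[of i N j] backward[of j N i] by blast
    qed
  qed
qed

lemma ex_rational_embedding:
  assumes H: "H \<subseteq> \<rat>" "H \<noteq> {}" and limpt: "\<And>x. x \<in> H \<Longrightarrow> x islimpt H"
  obtains h k where "h ` \<rat> \<subseteq> H" "homeomorphism \<rat> (h ` \<rat>) h k"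
    "\<And>x y. x \<in> \<rat> \<Longrightarrow> y \<in> \<rat> \<Longrightarrow> colour {x, y} = colour {h x, h y}"
proof -
  have "crowded {i. q i \<in> H}"
    by (rule crowded_index) (use H limpt in auto)
  moreover have "{i. q i \<in> H} \<noteq> {}"
    using H q_inv by (metis (mono_tags, lifting) all_not_in_conv mem_Collect_eq subset_eq)
  ultimately show ?thesis
  proof (rule ex_colour_embedding)
    fix g assume gH: "range g \<subseteq> {i. q i \<in> H}" and inj: "inj g"
      and col: "\<And>i j. card (alternations {A (g i), A (g j)}) = card (alternations {A i, A j})"
      and fwd: "\<And>i j N. agree N (A i) (A j) \<Longrightarrow> agree N (A (g i)) (A (g j))"
      and bwd: "\<And>N. \<exists>M. \<forall>i j. agree M (A (g i)) (A (g j)) \<longrightarrow> agree N (A i) (A j)"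
    define h where "h x = q (g (inv q x))" for x
    define k where "k y = q (inv g (inv q y))" for y
    have hq: "h (q i) = q (g i)" for i
      by (simp add: h_def)
    have kq: "k (q (g i)) = q i" for i
      by (simp add: k_def inj)
    have rat: "\<exists>i. x = q i" if "x \<in> \<rat>" for x
      using that q_inv by metis
    have cont_h: "continuous_on \<rat> h"
      unfolding continuous_on_iff
    proof (intro ballI allI impI)
      fix x e :: real assume "x \<in> \<rat>" "e > 0"
      then obtain i where x: "x = q i"
        using rat by blast
      obtain N where N: "\<And>j. agree N (A j) (A (g i)) \<Longrightarrow> \<bar>q j - q (g i)\<bar> < e"
        using agree_near \<open>e > 0\<close> by blast
      obtain d where "d > 0" and d: "\<And>j. \<bar>q j - q i\<bar> < d \<Longrightarrow> agree N (A j) (A i)"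
        using near_agree by blast
      have "dist (h y) (h x) < e" if "y \<in> \<rat>" "dist y x < d" for y
      proof -
        obtain j where "y = q j"
          using rat \<open>y \<in> \<rat>\<close> by blast
        with that x show ?thesis
          using N[OF fwd[OF d[of j]]] by (simp add: dist_real_def hq)
      qed
      with \<open>d > 0\<close> show "\<exists>d>0. \<forall>y\<in>\<rat>. dist y x < d \<longrightarrow> dist (h y) (h x) < e"
        by blast
    qed
    have cont_k: "continuous_on (h ` \<rat>) k"
      unfolding continuous_on_iff
    proof (intro ballI allI impI)
      fix x e :: real assume "x \<in> h ` \<rat>" "e > 0"
      then obtain i where x: "x = q (g i)"
        using rat hq by blast
      obtain N where N: "\<And>j. agree N (A j) (A i) \<Longrightarrow> \<bar>q j - q i\<bar> < e"
        using agree_near \<open>e > 0\<close> by blast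
      obtain M where M: "\<And>i j. agree M (A (g i)) (A (g j)) \<Longrightarrow> agree N (A i) (A j)"
        using bwd by blast
      obtain d where "d > 0" and d: "\<And>j. \<bar>q j - q (g i)\<bar> < d \<Longrightarrow> agree M (A j) (A (g i))"
        using near_agree by blast
      have "dist (k y) (k x) < e" if "y \<in> h ` \<rat>" "dist y x < d" for y
      proof -
        obtain j where "y = q (g j)"
          using rat hq \<open>y \<in> h ` \<rat>\<close> by blast
        with that x show ?thesis
          using N[OF M[OF d[of "g j"]]] by (simp add: dist_real_def kq)
      qed
      with \<open>d > 0\<close> show "\<exists>d>0. \<forall>y\<in>h ` \<rat>. dist y x < d \<longrightarrow> dist (k y) (k x) < e"
        by blast
    qed
    show ?thesis
    proof (rule that)
      show "h ` \<rat> \<subseteq> H"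
        using gH by (auto simp: h_def)
      have "k (h x) = x" if "x \<in> \<rat>" for x
        using rat[OF that] hq kq by auto
      then show "homeomorphism \<rat> (h ` \<rat>) h k"
        using cont_h cont_k by (force simp: homeomorphism_def image_iff)
      show "colour {x, y} = colour {h x, h y}" if "x \<in> \<rat>" "y \<in> \<rat>" for x y
        using rat[OF that(1)] rat[OF that(2)] by (auto simp: hq colour_pair col)
    qed
  qed
qed

end

section \<open>The tree of a sequence of irrational cuts\<close>

locale cuts =
  fixes q r :: "nat \<Rightarrow> real"
  assumes bij: "bij_betw q UNIV \<rat>"
    and irrational: "r k \<notin> \<rat>"
    and dense: "x < y \<Longrightarrow> \<exists>k. x < r k \<and> r k < y"
begin

text \<open>
  The pieces of the \<open>n\<close>-th partition are the fibres of \<open>side n\<close>; thus \<open>least n i\<close> is the index of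
  the first point in the piece of \<open>q i\<close>.
\<close>

definition side :: "nat \<Rightarrow> nat \<Rightarrow> nat set"
  where "side n i = {k. k < n \<and> q i < r k}"

definition least :: "nat \<Rightarrow> nat \<Rightarrow> nat"
  where "least n i = (LEAST j. side n j = side n i)"

definition branch :: "nat \<Rightarrow> nat set"
  where "branch i = range (\<lambda>n. least n i)"

lemma side_mono:
  assumes "side n i = side n j" "m \<le> n"
  shows "side m i = side m j"
proof -
  have "side m l = side n l \<inter> {..<m}" for l
    using assms(2) by (auto simp: side_def)
  then show ?thesis
    using assms(1) by simp
qed

lemma side_least: "side n (least n i) = side n i"
  unfolding least_def by (rule LeastI) simp

lemma least_le: "side n j = side n i \<Longrightarrow> least n i \<le> j"
  unfolding least_def by (rule Least_le)

lemma least_cong: "side n i = side n j \<Longrightarrow> least n i = least n j"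
  by (simp add: least_def)

lemma side_separates:
  assumes "i \<noteq> j"
  obtains n where "side n i \<noteq> side n j"
proof -
  have "q i \<noteq> q j"
    using assms bij by (auto simp: bij_betw_def inj_def)
  then consider "q i < q j" | "q j < q i"
    by linarith
  then obtain k where "q i < r k \<longleftrightarrow> \<not> q j < r k"
    using dense by (metis less_asym)
  then have "k \<in> side (Suc k) i \<longleftrightarrow> k \<notin> side (Suc k) j"
    by (simp add: side_def)
  with that show ?thesis
    by blast
qed

lemma side_isolates:
  obtains n where "\<And>l. l < N \<Longrightarrow> side n l = side n i \<Longrightarrow> l = i"
proof -
  have "\<exists>n. \<forall>l<N. side n l = side n i \<longrightarrow> l = i"
  proof (induction N)
    case (Suc N)
    then obtain n where n: "\<And>l. l < N \<Longrightarrow> side n l = side n i \<Longrightarrow> l = i"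
      by blast
    obtain m where m: "N \<noteq> i \<Longrightarrow> side m N \<noteq> side m i"
      using side_separates by metis
    have "l = i" if "l < Suc N" "side (max m n) l = side (max m n) i" for l
      using that n m side_mono[of "max m n" l i m] side_mono[of "max m n" l i n]
      by (metis less_SucE max.cobounded1 max.cobounded2)
    then show ?case
      by blast
  qed simp
  with that show ?thesis
    by blast
qed

lemma branch_zero: "0 \<in> branch i"
proof -
  have "least 0 i \<le> 0"
    by (rule least_le) (simp add: side_def)
  then show ?thesis
    by (metis branch_def le_zero_eq rangeI)
qed

lemma branch_self: "i \<in> branch i"
proof -
  obtain n where n: "\<And>l. l < i \<Longrightarrow> side n l = side n i \<Longrightarrow> l = i"
    using side_isolates by blast
  have "least n i \<le> i"
    by (rule least_le) simp
  then have "least n i = i"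
    using n[OF _ side_least] by (metis le_neq_implies_less)
  then show ?thesis
    by (metis branch_def rangeI)
qed

lemma branch_below: "branch i \<subseteq> {..i}"
  using least_le by (auto simp: branch_def)

text \<open>
  After a stage at which \<open>j\<close> is the first point in the piece of \<open>i\<close>, every first point met by \<open>i\<close> or \<open>j\<close>
  has index at least \<open>j\<close>; before it, \<open>i\<close> and \<open>j\<close> share their pieces.
\<close>

lemma branch_coherent:
  assumes "j \<in> branch i"
  shows "branch j = branch i \<inter> {..j}"
proof -
  obtain n where n: "j = least n i"
    using assms by (auto simp: branch_def)
  have same: "side n j = side n i"
    using n side_least by simp
  have late: "j \<le> least k l" if "n \<le> k" "side n l = side n i" for k l
    using least_le[of n "least k l" i] side_mono[OF side_least that(1), of l] that(2) n by simp
  have early: "least k j = least k i" if "k \<le> n" for k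
    using least_cong[OF side_mono[OF same that]] .
  show ?thesis
  proof (intro equalityI subsetI)
    fix l assume l: "l \<in> branch j"
    then obtain k where k: "l = least k j" and "l \<le> j"
      using branch_below by (auto simp: branch_def)
    show "l \<in> branch i \<inter> {..j}"
    proof (cases "k \<le> n")
      case True
      then show ?thesis
        using k early \<open>l \<le> j\<close> by (auto simp: branch_def)
    next
      case False
      then have "l = j"
        using late[of k j] same k \<open>l \<le> j\<close> by simp
      then show ?thesis
        using assms by simp
    qed
  next
    fix l assume l: "l \<in> branch i \<inter> {..j}"
    then obtain k where k: "l = least k i" and "l \<le> j"
      by (auto simp: branch_def)
    show "l \<in> branch j"
    proof (cases "k \<le> n")
      case True
      then show ?thesis
        unfolding branch_def using k early[OF True] by (metis rangeI)
    next
      case False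
      then have "l = j"
        using late[of k i] k \<open>l \<le> j\<close> by simp
      then show ?thesis
        using branch_self by simp
    qed
  qed
qed

lemma side_locally_constant: "\<exists>e>0. \<forall>j. \<bar>q j - q i\<bar> < e \<longrightarrow> side n j = side n i"
proof (induction n)
  case 0
  then show ?case
    by (auto simp: side_def intro: exI[of _ 1])
next
  case (Suc n)
  then obtain e where "e > 0" and e: "\<And>j. \<bar>q j - q i\<bar> < e \<Longrightarrow> side n j = side n i"
    by blast
  let ?d = "\<bar>q i - r n\<bar>"
  have "q i \<in> \<rat>"
    using bij by (auto simp: bij_betw_def)
  then have "?d > 0"
    using irrational[of n] by auto
  have Suc_side: "side (Suc n) j = side n j \<union> (if q j < r n then {n} else {})" for j
    by (auto simp: side_def less_Suc_eq)
  have "side (Suc n) j = side (Suc n) i" if "\<bar>q j - q i\<bar> < min e ?d" for j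
  proof -
    have "q j < r n \<longleftrightarrow> q i < r n"
      using that by (auto simp: abs_if split: if_splits)
    then show ?thesis
      using e[of j] that by (simp add: Suc_side)
  qed
  moreover have "min e ?d > 0"
    using \<open>e > 0\<close> \<open>?d > 0\<close> by simp
  ultimately show ?case
    by blast
qed

lemma branch_near_agree: "\<exists>e>0. \<forall>j. \<bar>q j - q i\<bar> < e \<longrightarrow> agree N (branch j) (branch i)"
proof -
  obtain n where n: "\<And>l. l < N \<Longrightarrow> side n l = side n i \<Longrightarrow> l = i"
    using side_isolates by blast
  \<comment> \<open>Within the piece of \<open>i\<close> at stage \<open>n\<close>, the only index below \<open>N\<close> that can occur is \<open>i\<close>.\<close>
  have half: "branch j \<inter> {..<N} \<subseteq> branch j'"
    if j: "side n j = side n i" and j': "side n j' = side n i" for j j'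
  proof
    fix l assume "l \<in> branch j \<inter> {..<N}"
    then obtain k where k: "l = least k j" "l < N"
      by (auto simp: branch_def)
    show "l \<in> branch j'"
    proof (cases "k \<le> n")
      case True
      then have "l = least k j'"
        using k(1) least_cong[OF side_mono[of n j j' k]] j j' by simp
      then show ?thesis
        by (auto simp: branch_def)
    next
      case False
      then have "side n l = side n i"
        using k(1) side_mono[OF side_least, of n k j] j by simp
      then have "l = i"
        using n k(2) by blast
      have "least n j' \<le> i"
        using j' by (intro least_le) simp
      then have "least n j' = i"
        using n[of "least n j'"] side_least[of n j'] j' k(2) \<open>l = i\<close> by simp
      then show ?thesis
        using \<open>l = i\<close> by (auto simp: branch_def)
    qed
  qed
  obtain e where "e > 0" and e: "\<And>j. \<bar>q j - q i\<bar> < e \<Longrightarrow> side n j = side n i"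
    using side_locally_constant by blast
  have "agree N (branch j) (branch i)" if "\<bar>q j - q i\<bar> < e" for j
    using half[of j i] half[of i j] e[OF that] by blast
  with \<open>e > 0\<close> show ?thesis
    by blast
qed

text \<open>
  The partition at stage \<open>n\<close> is finite, so from some \<open>N\<close> on agreement of two branches makes the
  first points of both pieces belong to both branches. Since first points move up as the
  partition is refined, the two pieces then coincide.
\<close>

lemma branch_agree_side: "\<exists>N. \<forall>j. agree N (branch j) (branch i) \<longrightarrow> side n j = side n i"
proof -
  have "finite (range (side n))"
    by (rule finite_subset[of _ "Pow {..<n}"]) (auto simp: side_def)
  then have "finite ((\<lambda>v. LEAST j. side n j = v) ` range (side n))"
    by (rule finite_imageI)
  then have fin: "finite (range (least n))"
    by (simp add: least_def image_image)
  let ?N = "Suc (Max (range (least n)))"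
  have bound: "least n l < ?N" for l
    using fin by (simp add: less_Suc_eq_le)
  have in_branch: "least n l \<in> branch l \<inter> {..<?N}" for l
    using bound by (auto simp: branch_def)
  have le: "side n a = side n b \<or> least n b \<le> least n a"
    if "least n b \<in> branch a" for a b
  proof -
    obtain k where k: "least n b = least k a"
      using \<open>least n b \<in> branch a\<close> by (auto simp: branch_def)
    show ?thesis
    proof (cases "k \<le> n")
      case True
      have "side k (least n a) = side k a"
        using side_mono[OF side_least True] .
      then show ?thesis
        using k least_le[of k "least n a" a] by simp
    next
      case False
      then have "side n (least k a) = side n a"
        using side_mono[OF side_least, of n k a] by simp
      then show ?thesis
        using k side_least[of n b] by simp
    qed
  qed
  have "side n j = side n i" if agr: "agree ?N (branch j) (branch i)" for j
  proof -
    have "least n j \<in> branch i" "least n i \<in> branch j"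
      using in_branch[of j] in_branch[of i] agr by blast+
    then have "side n j = side n i \<or> least n j = least n i"
      using le[of j i] le[of i j] by auto
    then show ?thesis
      using side_least by metis
  qed
  then show ?thesis
    by blast
qed

lemma branch_agree_near:
  assumes "e > 0"
  shows "\<exists>N. \<forall>j. agree N (branch j) (branch i) \<longrightarrow> \<bar>q j - q i\<bar> < e"
proof -
  obtain k where k: "q i - e < r k" "r k < q i"
    using dense[of "q i - e" "q i"] assms by auto
  obtain l where l: "q i < r l" "r l < q i + e"
    using dense[of "q i" "q i + e"] assms by auto
  let ?n = "Suc (max k l)"
  have "\<bar>q j - q i\<bar> < e" if "side ?n j = side ?n i" for j
  proof -
    have "k \<notin> side ?n j" "l \<in> side ?n j"
      using k l that by (auto simp: side_def)
    then have "\<not> q j < r k" "q j < r l"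
      by (auto simp: side_def)
    with k l show ?thesis
      by auto
  qed
  then show ?thesis
    using branch_agree_side[of i ?n] by blast
qed

lemma rational_tree_branch: "rational_tree q branch"
  by unfold_locales
    (simp_all add: bij branch_zero branch_self branch_below branch_coherent branch_near_agree
      branch_agree_near)

end

lemma ex_rational_tree: "\<exists>q A. rational_tree q A"
proof -
  define q :: "nat \<Rightarrow> real" where "q = from_nat_into \<rat>"
  have "infinite (\<rat> :: real set)"
    by (rule Rats_infinite)
  then have bij: "bij_betw q UNIV \<rat>"
    unfolding q_def by (intro bij_betw_from_nat_into countable_rat)
  obtain \<alpha> :: real where \<alpha>: "\<alpha> \<notin> \<rat>"
    using uncountable_UNIV_real countable_rat by (metis UNIV_eq_I)
  have "cuts q (\<lambda>k. q k + \<alpha>)"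
  proof
    show "q k + \<alpha> \<notin> \<rat>" for k
    proof
      assume "q k + \<alpha> \<in> \<rat>"
      moreover have "q k \<in> \<rat>"
        using bij by (auto simp: bij_betw_def)
      ultimately have "q k + \<alpha> - q k \<in> \<rat>"
        by (rule Rats_diff)
      with \<alpha> show False
        by simp
    qed
    show "\<exists>k. x < q k + \<alpha> \<and> q k + \<alpha> < y" if xy: "x < y" for x y
    proof -
      obtain z where z: "z \<in> \<rat>" "x - \<alpha> < z" "z < y - \<alpha>"
        using Rats_dense_in_real[of "x - \<alpha>" "y - \<alpha>"] diff_strict_right_mono[OF xy] by blast
      then obtain k where "z = q k"
        using bij by (auto simp: bij_betw_def)
      with z show ?thesis
        by (intro exI[of _ k]) linarith
    qed
  qed (rule bij)
  then show ?thesis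
    using cuts.rational_tree_branch by blast
qed

section \<open>The colouring theorem\<close>

theorem theorem1p4:
  shows "\<exists>c :: real set \<Rightarrow> nat.
    c ` [\<rat>]\<^bsup>2\<^esup> = UNIV \<and>
    (\<forall>H. H \<subseteq> (\<rat> :: real set) \<and> H homeomorphic (\<rat> :: real set) \<longrightarrow>
       (\<exists>h k. h ` \<rat> \<subseteq> H \<and> homeomorphism (\<rat> :: real set) (h ` \<rat>) h k \<and>
          (\<forall>x\<in>\<rat>. \<forall>y\<in>\<rat>. x \<noteq> y \<longrightarrow> c {x, y} = c {h x, h y})) \<and>
       c ` [H]\<^bsup>2\<^esup> = UNIV)"
proof -
  obtain q A where "rational_tree q A"
    using ex_rational_tree by blast
  then interpret rational_tree q A .
  show ?thesis
  proof (intro exI[of _ colour] conjI allI impI)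
    show "colour ` [\<rat>]\<^bsup>2\<^esup> = UNIV"
      by (rule colour_onto)
  next
    fix H :: "real set" assume H: "H \<subseteq> \<rat> \<and> H homeomorphic (\<rat> :: real set)"
    have "H \<noteq> {}"
      using H Rats_0 by (metis empty_iff homeomorphic_empty(2))
    then obtain h k where h: "h ` \<rat> \<subseteq> H" "homeomorphism \<rat> (h ` \<rat>) h k"
      "\<And>x y. x \<in> \<rat> \<Longrightarrow> y \<in> \<rat> \<Longrightarrow> colour {x, y} = colour {h x, h y}"
      using ex_rational_embedding homeomorphic_rat_islimpt H by metis
    then show "\<exists>h k. h ` \<rat> \<subseteq> H \<and> homeomorphism \<rat> (h ` \<rat>) h k \<and>
        (\<forall>x\<in>\<rat>. \<forall>y\<in>\<rat>. x \<noteq> y \<longrightarrow> colour {x, y} = colour {h x, h y})"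
      by blast
    have inj: "inj_on h \<rat>"
      using h(2) by (metis homeomorphism_apply1 inj_on_inverseI)
    have "colour ` [\<rat>]\<^bsup>2\<^esup> \<subseteq> colour ` [H]\<^bsup>2\<^esup>"
    proof
      fix n assume "n \<in> colour ` [\<rat>]\<^bsup>2\<^esup>"
      then obtain x y where xy: "x \<in> \<rat>" "y \<in> \<rat>" "x \<noteq> y" "n = colour {x, y}"
        by (auto simp: nsets_def card_2_iff)
      then have "h x \<noteq> h y" "h x \<in> H" "h y \<in> H"
        using h(1) inj by (auto simp: inj_on_eq_iff)
      then have "{h x, h y} \<in> [H]\<^bsup>2\<^esup>"
        by (simp add: nsets_def)
      with xy h(3) show "n \<in> colour ` [H]\<^bsup>2\<^esup>"
        by blast
    qed
    then show "colour ` [H]\<^bsup>2\<^esup> = UNIV"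
      by (simp add: colour_onto top.extremum_unique)
  qed
qed

end
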